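(* Let $m,n\ge 1$, $p_1,\dots,p_m\in S_n(1)$, $C_1,\dots,C_m\in\mathbb{R}_+^{n\times n}$, weights $w_l\ge 0$ with $\sum_{l=1}^m w_l=1$, and $\gamma>0$. For every given $\varepsilon'>0$, the Dual Iterative Bregman Projection algorithm (described in the context) stops after a number of iterations $N$ satisfying $$N\le 4+\frac{44R_v}{\varepsilon'}=O\left(\frac{\max_l\|C_l\|_\infty}{\gamma\varepsilon'}\right),\qquad R_v:=\max_l\frac{\|C_l\|_\infty}{\gamma}+\sum_{k=1}^m w_k\frac{\|C_k\|_\infty}{\gamma}.$$ It returns matrices $B_1,\dots,B_m$ such that $$\sum_{l=1}^m w_l\left\|B_l^T\mathbf 1-\bar q\right\|_1\le\varepsilon',\qquad \bar q=\sum_{l=1}^m w_lB_l^T\mathbf 1,$$ and $$\sum_{l=1}^m w_l\bigl(\langle C_l,B_l\rangle+\gamma H(B_l)\bigr)-\sum_{l=1}^m w_l\bigl(\langle C_l,\pi^*_{\gamma,l}\rangle+\gamma H(\pi^*_{\gamma,l})\bigr)\le\max_l\|C_l\|_\infty\,\varepsilon',$$ where $[\pi^*_{\gamma,1},\dots,\pi^*_{\gamma,m}]$ is a solution of the regularized barycenter problem $$\min\ \sum_{l=1}^m w_l\bigl\{\langle\pi_l,C_l\rangle+\gamma H(\pi_l)\bigr\}\quad\text{over }\pi_l\in\mathbb{R}_+^{n\times n},\ \pi_l\mathbf 1=p_l\ (l=1,\dots,m),\ \pi_1^T\mathbf 1=\dots=\pi_m^T\mathbf 1 .$$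
   Context: $S_n(1)=\{q\in\mathbb{R}_+^n:\sum_i q_i=1\}$; $\mathbf 1$ is the all-ones column vector; $\langle A,B\rangle=\sum_{i,j}A_{ij}B_{ij}$; $\|C\|_\infty$ is the maximal element of the nonnegative matrix $C$; $H(\pi)=\sum_{i,j}\pi_{ij}(\ln\pi_{ij}-1)$. Logarithms and exponentials of vectors and matrices are element-wise. Conventions when some $p_l$ has zero entries: $0\ln0=0$, $\ln0=-\infty$, $e^{-\infty}=0$. Let $K_l=\exp(-C_l/\gamma)$ (element-wise) and $B_l(u_l,v_l)=\mathrm{diag}(e^{u_l})K_l\,\mathrm{diag}(e^{v_l})$. Dual Iterative Bregman Projection algorithm: start with $t=0$ and $u_l^0=v_l^0=0\in\mathbb{R}^n$ for $l=1,\dots,m$. Repeat: (i) for all $l$, $v_l^{t+1}:=\sum_{k=1}^m w_k\ln(K_k^Te^{u_k^t})-\ln(K_l^Te^{u_l^t})$ and $u_l^{t+1}:=u_l^t$; then $t:=t+1$; (ii) for all $l$, $u_l^{t+1}:=\ln p_l-\ln(K_le^{v_l^t})$ and $v_l^{t+1}:=v_l^t$; then $t:=t+1$; until $\sum_{l=1}^m w_l\|B_l^T(u_l^t,v_l^t)\mathbf 1-\bar q^t\|_1\le\varepsilon'$, where $\bar q^t:=\sum_{l=1}^m w_lB_l^T(u_l^t,v_l^t)\mathbf 1$. Output $B_l=B_l(u_l^t,v_l^t)$, $l=1,\dots,m$. The number of iterations $N$ is the value of the counter $t$ when the algorithm stops (each of the half-steps (i) and (ii) counts as one iteration). *)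

theory Defs
  imports Complex_Main "HOL-Library.Extended_Real" "HOL-Library.Landau_Symbols"
begin

text \<open>
  Vectors of length \<open>n\<close> and \<open>n \<times> n\<close> matrices are functions on \<open>nat\<close> of which only the entries
  with indices below \<open>n\<close> are used; families \<open>p, C, w, u, v, B\<close> take the index \<open>l < m\<close> first.
  The dimensions are not types because the asymptotic bound is uniform in them.
\<close>

definition prob_simplex :: "nat \<Rightarrow> (nat \<Rightarrow> real) set" where
  "prob_simplex n = {q. (\<forall>i<n. 0 \<le> q i) \<and> (\<Sum>i<n. q i) = 1}"

definition mat_vec :: "nat \<Rightarrow> (nat \<Rightarrow> nat \<Rightarrow> real) \<Rightarrow> (nat \<Rightarrow> real) \<Rightarrow> nat \<Rightarrow> real" where
  "mat_vec n A x = (\<lambda>i. \<Sum>j<n. A i j * x j)"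

definition mat_transpose :: "(nat \<Rightarrow> nat \<Rightarrow> real) \<Rightarrow> nat \<Rightarrow> nat \<Rightarrow> real" where
  "mat_transpose A = (\<lambda>i j. A j i)"

definition ones :: "nat \<Rightarrow> real" where
  "ones = (\<lambda>_. 1)"

definition frob :: "nat \<Rightarrow> (nat \<Rightarrow> nat \<Rightarrow> real) \<Rightarrow> (nat \<Rightarrow> nat \<Rightarrow> real) \<Rightarrow> real" where
  "frob n A B = (\<Sum>i<n. \<Sum>j<n. A i j * B i j)"

definition l1_norm :: "nat \<Rightarrow> (nat \<Rightarrow> real) \<Rightarrow> real" where
  "l1_norm n x = (\<Sum>i<n. \<bar>x i\<bar>)"

definition max_entry :: "nat \<Rightarrow> (nat \<Rightarrow> nat \<Rightarrow> real) \<Rightarrow> real" where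
  "max_entry n C = (MAX (i, j) \<in> {..<n} \<times> {..<n}. C i j)"

text \<open>The convention \<open>0 ln 0 = 0\<close> holds here because \<open>ln 0\<close> on the reals is a (junk) real number.\<close>

definition entropy :: "nat \<Rightarrow> (nat \<Rightarrow> nat \<Rightarrow> real) \<Rightarrow> real" where
  "entropy n \<pi> = (\<Sum>i<n. \<Sum>j<n. \<pi> i j * (ln (\<pi> i j) - 1))"

text \<open>
  Logarithm of a nonnegative real and exponential of an element of \<open>[-\<infinity>, \<infinity>)\<close>, with
  \<open>ln 0 = -\<infinity>\<close> and \<open>exp (-\<infinity>) = 0\<close>.  The value \<open>\<infinity>\<close> does not occur in the algorithm.
\<close>

definition ln_ext :: "real \<Rightarrow> ereal" where
  "ln_ext x = (if x = 0 then -\<infinity> else ereal (ln x))"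

definition exp_ext :: "ereal \<Rightarrow> real" where
  "exp_ext x = (if x = -\<infinity> then 0 else exp (real_of_ereal x))"

definition kernel :: "real \<Rightarrow> (nat \<Rightarrow> nat \<Rightarrow> real) \<Rightarrow> nat \<Rightarrow> nat \<Rightarrow> real" where
  "kernel \<gamma> C = (\<lambda>i j. exp (- C i j / \<gamma>))"

definition scaled_kernel ::
  "real \<Rightarrow> (nat \<Rightarrow> nat \<Rightarrow> real) \<Rightarrow> (nat \<Rightarrow> ereal) \<Rightarrow> (nat \<Rightarrow> ereal) \<Rightarrow> nat \<Rightarrow> nat \<Rightarrow> real" where
  "scaled_kernel \<gamma> C u v = (\<lambda>i j. exp_ext (u i) * kernel \<gamma> C i j * exp_ext (v j))"

definition v_step ::
  "nat \<Rightarrow> nat \<Rightarrow> (nat \<Rightarrow> nat \<Rightarrow> nat \<Rightarrow> real) \<Rightarrow> (nat \<Rightarrow> real) \<Rightarrow> real \<Rightarrow>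
   (nat \<Rightarrow> nat \<Rightarrow> ereal) \<Rightarrow> nat \<Rightarrow> nat \<Rightarrow> ereal" where
  "v_step m n C w \<gamma> u = (\<lambda>l j.
     (\<Sum>k<m. ereal (w k) * ln_ext (mat_vec n (mat_transpose (kernel \<gamma> (C k))) (\<lambda>i. exp_ext (u k i)) j))
     - ln_ext (mat_vec n (mat_transpose (kernel \<gamma> (C l))) (\<lambda>i. exp_ext (u l i)) j))"

definition u_step ::
  "nat \<Rightarrow> (nat \<Rightarrow> nat \<Rightarrow> real) \<Rightarrow> (nat \<Rightarrow> nat \<Rightarrow> nat \<Rightarrow> real) \<Rightarrow> real \<Rightarrow>
   (nat \<Rightarrow> nat \<Rightarrow> ereal) \<Rightarrow> nat \<Rightarrow> nat \<Rightarrow> ereal" where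
  "u_step n p C \<gamma> v = (\<lambda>l i.
     ln_ext (p l i) - ln_ext (mat_vec n (kernel \<gamma> (C l)) (\<lambda>j. exp_ext (v l j)) i))"

primrec dibp ::
  "nat \<Rightarrow> nat \<Rightarrow> (nat \<Rightarrow> nat \<Rightarrow> real) \<Rightarrow> (nat \<Rightarrow> nat \<Rightarrow> nat \<Rightarrow> real) \<Rightarrow> (nat \<Rightarrow> real) \<Rightarrow> real \<Rightarrow>
   nat \<Rightarrow> (nat \<Rightarrow> nat \<Rightarrow> ereal) \<times> (nat \<Rightarrow> nat \<Rightarrow> ereal)" where
  "dibp m n p C w \<gamma> 0 = ((\<lambda>_ _. 0), (\<lambda>_ _. 0))"
| "dibp m n p C w \<gamma> (Suc t) =
     (case dibp m n p C w \<gamma> t of (u, v) \<Rightarrow>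
        if even t then (u, v_step m n C w \<gamma> u) else (u_step n p C \<gamma> v, v))"

definition dibp_plan ::
  "nat \<Rightarrow> nat \<Rightarrow> (nat \<Rightarrow> nat \<Rightarrow> real) \<Rightarrow> (nat \<Rightarrow> nat \<Rightarrow> nat \<Rightarrow> real) \<Rightarrow> (nat \<Rightarrow> real) \<Rightarrow> real \<Rightarrow>
   nat \<Rightarrow> nat \<Rightarrow> nat \<Rightarrow> nat \<Rightarrow> real" where
  "dibp_plan m n p C w \<gamma> t = (\<lambda>l.
     case dibp m n p C w \<gamma> t of (u, v) \<Rightarrow> scaled_kernel \<gamma> (C l) (u l) (v l))"

definition mean_marginal ::
  "nat \<Rightarrow> nat \<Rightarrow> (nat \<Rightarrow> real) \<Rightarrow> (nat \<Rightarrow> nat \<Rightarrow> nat \<Rightarrow> real) \<Rightarrow> nat \<Rightarrow> real" where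
  "mean_marginal m n w B = (\<lambda>j. \<Sum>l<m. w l * mat_vec n (mat_transpose (B l)) ones j)"

definition marginal_gap ::
  "nat \<Rightarrow> nat \<Rightarrow> (nat \<Rightarrow> real) \<Rightarrow> (nat \<Rightarrow> nat \<Rightarrow> nat \<Rightarrow> real) \<Rightarrow> real" where
  "marginal_gap m n w B =
     (\<Sum>l<m. w l * l1_norm n (\<lambda>j. mat_vec n (mat_transpose (B l)) ones j - mean_marginal m n w B j))"

text \<open>
  The stopping test is evaluated at the end of the loop body only, that is, at the counter
  values \<open>t = 2, 4, 6, \<dots>\<close>.
\<close>

definition dibp_exit ::
  "nat \<Rightarrow> nat \<Rightarrow> (nat \<Rightarrow> nat \<Rightarrow> real) \<Rightarrow> (nat \<Rightarrow> nat \<Rightarrow> nat \<Rightarrow> real) \<Rightarrow> (nat \<Rightarrow> real) \<Rightarrow> real \<Rightarrow>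
   real \<Rightarrow> nat \<Rightarrow> bool" where
  "dibp_exit m n p C w \<gamma> \<epsilon> t \<longleftrightarrow>
     0 < t \<and> even t \<and> marginal_gap m n w (dibp_plan m n p C w \<gamma> t) \<le> \<epsilon>"

definition dibp_stops_after ::
  "nat \<Rightarrow> nat \<Rightarrow> (nat \<Rightarrow> nat \<Rightarrow> real) \<Rightarrow> (nat \<Rightarrow> nat \<Rightarrow> nat \<Rightarrow> real) \<Rightarrow> (nat \<Rightarrow> real) \<Rightarrow> real \<Rightarrow>
   real \<Rightarrow> nat \<Rightarrow> bool" where
  "dibp_stops_after m n p C w \<gamma> \<epsilon> N \<longleftrightarrow>
     dibp_exit m n p C w \<gamma> \<epsilon> N \<and> (\<forall>t<N. \<not> dibp_exit m n p C w \<gamma> \<epsilon> t)"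

definition objective ::
  "nat \<Rightarrow> nat \<Rightarrow> (nat \<Rightarrow> nat \<Rightarrow> nat \<Rightarrow> real) \<Rightarrow> (nat \<Rightarrow> real) \<Rightarrow> real \<Rightarrow>
   (nat \<Rightarrow> nat \<Rightarrow> nat \<Rightarrow> real) \<Rightarrow> real" where
  "objective m n C w \<gamma> \<pi> = (\<Sum>l<m. w l * (frob n (C l) (\<pi> l) + \<gamma> * entropy n (\<pi> l)))"

definition feasible ::
  "nat \<Rightarrow> nat \<Rightarrow> (nat \<Rightarrow> nat \<Rightarrow> real) \<Rightarrow> (nat \<Rightarrow> nat \<Rightarrow> nat \<Rightarrow> real) \<Rightarrow> bool" where
  "feasible m n p \<pi> \<longleftrightarrow>
     (\<forall>l<m. \<forall>i<n. \<forall>j<n. 0 \<le> \<pi> l i j) \<and>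
     (\<forall>l<m. \<forall>i<n. mat_vec n (\<pi> l) ones i = p l i) \<and>
     (\<forall>k<m. \<forall>l<m. \<forall>j<n. mat_vec n (mat_transpose (\<pi> k)) ones j = mat_vec n (mat_transpose (\<pi> l)) ones j)"

definition barycenter_solution ::
  "nat \<Rightarrow> nat \<Rightarrow> (nat \<Rightarrow> nat \<Rightarrow> real) \<Rightarrow> (nat \<Rightarrow> nat \<Rightarrow> nat \<Rightarrow> real) \<Rightarrow> (nat \<Rightarrow> real) \<Rightarrow> real \<Rightarrow>
   (nat \<Rightarrow> nat \<Rightarrow> nat \<Rightarrow> real) \<Rightarrow> bool" where
  "barycenter_solution m n p C w \<gamma> \<pi> \<longleftrightarrow> is_arg_min (objective m n C w \<gamma>) (feasible m n p) \<pi>"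

definition barycenter_data ::
  "nat \<Rightarrow> nat \<Rightarrow> (nat \<Rightarrow> nat \<Rightarrow> real) \<Rightarrow> (nat \<Rightarrow> nat \<Rightarrow> nat \<Rightarrow> real) \<Rightarrow> (nat \<Rightarrow> real) \<Rightarrow> real \<Rightarrow>
   bool" where
  "barycenter_data m n p C w \<gamma> \<longleftrightarrow>
     1 \<le> m \<and> 1 \<le> n \<and> (\<forall>l<m. p l \<in> prob_simplex n) \<and> (\<forall>l<m. \<forall>i<n. \<forall>j<n. 0 \<le> C l i j) \<and>
     (\<forall>l<m. 0 \<le> w l) \<and> (\<Sum>l<m. w l) = 1 \<and> 0 < \<gamma>"

definition R_v ::
  "nat \<Rightarrow> nat \<Rightarrow> (nat \<Rightarrow> nat \<Rightarrow> nat \<Rightarrow> real) \<Rightarrow> (nat \<Rightarrow> real) \<Rightarrow> real \<Rightarrow> real" where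
  "R_v m n C w \<gamma> =
     (MAX l\<in>{..<m}. max_entry n (C l) / \<gamma>) + (\<Sum>k<m. w k * (max_entry n (C k) / \<gamma>))"

definition cost_ratio ::
  "nat \<Rightarrow> nat \<Rightarrow> (nat \<Rightarrow> nat \<Rightarrow> nat \<Rightarrow> real) \<Rightarrow> real \<Rightarrow> real \<Rightarrow> real" where
  "cost_ratio m n C \<gamma> \<epsilon> = (MAX l\<in>{..<m}. max_entry n (C l)) / (\<gamma> * \<epsilon>)"

text \<open>
  The filter on tuples \<open>(m, n, p, C, w, \<gamma>, \<epsilon>)\<close> of admissible data along which
  \<open>cost_ratio m n C \<gamma> \<epsilon>\<close> tends to infinity.  A Landau bound along it has a constant that depends
  on none of the parameters, not even on the dimensions.  Some such regime is implicit in the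
  bound: \<open>4 + 44 R / \<epsilon>\<close> is at least \<open>4\<close>, whereas \<open>cost_ratio\<close> can be arbitrarily small.
\<close>

definition large_cost_ratio ::
  "(nat \<times> nat \<times> (nat \<Rightarrow> nat \<Rightarrow> real) \<times> (nat \<Rightarrow> nat \<Rightarrow> nat \<Rightarrow> real) \<times> (nat \<Rightarrow> real) \<times> real \<times> real)
   filter" where
  "large_cost_ratio =
     inf (filtercomap (\<lambda>(m, n, p, C, w, \<gamma>, \<epsilon>). cost_ratio m n C \<gamma> \<epsilon>) at_top)
         (principal {(m, n, p, C, w, \<gamma>, \<epsilon>). barycenter_data m n p C w \<gamma> \<and> 0 < \<epsilon>})"

end

theory Submission
  imports Defs "HOL-Analysis.Convex"
begin

text \<open>
  Write \<open>B k\<close> and \<open>v k\<close> for the plans and the \<open>v\<close>-variables at the counter value \<open>2 k\<close>, \<open>k \<ge> 1\<close>,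
  \<open>gap k\<close> for the quantity in the stopping test, and \<open>R\<close> for \<open>R_v\<close>.  The first marginals of \<open>B k\<close>
  are exact, and the second marginals of all plans become equal, namely to the geometric mean of the
  previous ones, after a \<open>v\<close>-step.  Hence one round of the algorithm decreases the dual objective by
  at least the deficit of the mass of that geometric mean, which dominates \<open>(gap k)\<^sup>2 / 9\<close>.
  Conversely, convexity and \<open>\<Sum>\<^sub>l w\<^sub>l v\<^sub>l = 0\<close> bound the decrease between round \<open>k\<close> and any
  later round by \<open>R gap k\<close>, because the oscillation of each \<open>v\<^sub>l\<close> is at most \<open>R\<close>; comparing with
  later iterates makes the existence of a dual optimum unnecessary.  The two estimates limit the
  number of rounds with \<open>gap k > \<epsilon>\<close> to \<open>1 + 22 R / \<epsilon>\<close>.  The bound on the objective is the same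
  convexity estimate, applied to a feasible family of plans in place of a later iterate.
\<close>

section \<open>Inequalities\<close>

text \<open>Jensen's inequality for \<open>exp\<close>: the tangent line at the weighted mean
  \<open>y\<close> lies below the graph, and averaging it returns \<open>exp y\<close>.\<close>

lemma exp_weighted_sum_le:
  fixes w x :: "nat \<Rightarrow> real"
  assumes "\<And>k. k < m \<Longrightarrow> 0 \<le> w k" and "(\<Sum>k<m. w k) = 1"
  shows "exp (\<Sum>k<m. w k * x k) \<le> (\<Sum>k<m. w k * exp (x k))"
proof -
  define y where "y = (\<Sum>k<m. w k * x k)"
  have tangent: "exp y * (1 + (x k - y)) \<le> exp (x k)" for k
  proof -
    have "exp y * (1 + (x k - y)) \<le> exp y * exp (x k - y)"
      by (intro mult_left_mono exp_ge_add_one_self) auto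
    then show ?thesis by (simp flip: exp_add)
  qed
  have "(\<Sum>k<m. w k * (exp y * (1 + (x k - y)))) = (\<Sum>k<m. exp y * (w k * x k) + exp y * (1 - y) * w k)"
    by (simp add: algebra_simps)
  also have "\<dots> = exp y * y + exp y * (1 - y) * (\<Sum>k<m. w k)"
    by (simp add: sum.distrib y_def flip: sum_distrib_left)
  finally have "(\<Sum>k<m. w k * (exp y * (1 + (x k - y)))) = exp y * y + exp y * (1 - y) * (\<Sum>k<m. w k)" .
  then have "exp y = (\<Sum>k<m. w k * (exp y * (1 + (x k - y))))"
    by (simp add: assms algebra_simps)
  also have "\<dots> \<le> (\<Sum>k<m. w k * exp (x k))"
    by (intro sum_mono mult_left_mono tangent) (use assms in auto)
  finally show ?thesis by (simp add: y_def)
qed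

text \<open>Pointwise nonnegativity of the generalized Kullback-Leibler divergence, from
  \<open>ln t \<le> t - 1\<close> at \<open>t = y / x\<close>. At \<open>x = 0\<close> the factor
  \<open>x\<close> removes the junk value \<open>ln 0\<close>.\<close>

lemma diff_le_mult_ln_diff:
  fixes x y :: real
  assumes "0 \<le> x" and "0 < y"
  shows "x - y \<le> x * (ln x - ln y)"
proof (cases "x = 0")
  case False
  then have "0 < x" using assms by simp
  then have "ln (y / x) \<le> y / x - 1"
    using assms by (intro ln_le_minus_one) simp
  then have "x * (ln y - ln x) \<le> x * (y / x - 1)"
    using \<open>0 < x\<close> assms by (simp add: ln_div)
  then show ?thesis using \<open>0 < x\<close> by (simp add: algebra_simps)
qed (use assms in simp)

text \<open>Since \<open>x\<close> has sum zero, \<open>y\<close> may be shifted by a constant. Its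
  values lie in an interval of length \<open>2 * R\<close> starting at the minimum
  \<open>y0\<close>; centring at \<open>y0 + R\<close> leaves absolute values of at most
  \<open>R\<close>.\<close>

lemma sum_mult_le_oscillation:
  fixes x y :: "nat \<Rightarrow> real"
  assumes "(\<Sum>j<n. x j) = 0" and osc: "\<And>i j. i < n \<Longrightarrow> j < n \<Longrightarrow> y i - y j \<le> 2 * R"
  shows "(\<Sum>j<n. x j * y j) \<le> R * (\<Sum>j<n. \<bar>x j\<bar>)"
proof (cases "n = 0")
  case False
  define y0 where "y0 = Min (y ` {..<n})"
  have "y0 \<in> y ` {..<n}" unfolding y0_def using False by (intro Min_in) auto
  then obtain j0 where j0: "j0 < n" "y0 = y j0" by auto
  have abs: "\<bar>y j - (y0 + R)\<bar> \<le> R" if "j < n" for j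
  proof -
    have "y0 \<le> y j" unfolding y0_def using that by (intro Min_le) auto
    with osc[OF that j0(1)] j0(2) show ?thesis by auto
  qed
  have "(\<Sum>j<n. x j * y j) = (\<Sum>j<n. x j * (y j - (y0 + R))) + (y0 + R) * (\<Sum>j<n. x j)"
    by (simp add: sum_distrib_left sum.distrib sum_subtractf algebra_simps)
  also have "\<dots> = (\<Sum>j<n. x j * (y j - (y0 + R)))" by (simp add: assms)
  also have "\<dots> \<le> (\<Sum>j<n. R * \<bar>x j\<bar>)"
  proof (rule sum_mono)
    fix j assume "j \<in> {..<n}"
    have "x j * (y j - (y0 + R)) \<le> \<bar>x j\<bar> * \<bar>y j - (y0 + R)\<bar>"
      by (metis abs_ge_self abs_mult)
    also have "\<dots> \<le> \<bar>x j\<bar> * R"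
      using abs \<open>j \<in> {..<n}\<close> by (intro mult_left_mono) auto
    finally show "x j * (y j - (y0 + R)) \<le> R * \<bar>x j\<bar>" by (simp add: mult.commute)
  qed
  finally show ?thesis by (simp add: sum_distrib_left)
qed simp

text \<open>
  Applying the arithmetic-geometric mean inequality to the square roots bounds the deficit of the
  geometric mean below by the variance of the square roots (for two equal weights, half the squared
  Hellinger distance), and Cauchy-Schwarz compares that variance with the \<open>L\<^sup>1\<close> deviation.
\<close>

lemma l1_deviation_le_geometric_mean_deficit:
  fixes w :: "nat \<Rightarrow> real" and q :: "nat \<Rightarrow> nat \<Rightarrow> real"
  assumes w: "\<And>k. k < m \<Longrightarrow> 0 \<le> w k" "(\<Sum>k<m. w k) = 1"
    and pos: "\<And>k j. k < m \<Longrightarrow> j < n \<Longrightarrow> 0 < q k j"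
    and mass: "\<And>k. k < m \<Longrightarrow> (\<Sum>j<n. q k j) = 1"
  shows "(\<Sum>k<m. w k * (\<Sum>j<n. \<bar>q k j - (\<Sum>l<m. w l * q l j)\<bar>))\<^sup>2
           \<le> 9 * (1 - (\<Sum>j<n. exp (\<Sum>k<m. w k * ln (q k j))))"
proof -
  define qb where "qb j = (\<Sum>l<m. w l * q l j)" for j
  define s where "s j = (\<Sum>k<m. w k * sqrt (q k j))" for j
  define I where "I = {..<n} \<times> {..<m}"
  define V where "V = (\<Sum>j<n. \<Sum>k<m. w k * (sqrt (q k j) - s j)\<^sup>2)"
  define W where "W = (\<Sum>j<n. \<Sum>k<m. w k * (sqrt (q k j) + s j)\<^sup>2)"
  have s0: "0 \<le> s j" if "j < n" for j
    unfolding s_def using w pos that by (intro sum_nonneg mult_nonneg_nonneg) (auto intro: less_imp_le)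
  have qb1: "(\<Sum>j<n. qb j) = 1"
  proof -
    have "(\<Sum>j<n. qb j) = (\<Sum>l<m. w l * (\<Sum>j<n. q l j))"
      unfolding qb_def sum_distrib_left by (rule sum.swap)
    then show ?thesis by (simp add: mass w)
  qed
  \<comment> \<open>\<open>c = -1\<close> gives the variance of the square roots,
    \<open>c = 1\<close> the summands of \<open>W\<close>.\<close>
  have expand: "(\<Sum>k<m. w k * (sqrt (q k j) + c * s j)\<^sup>2) = qb j + (2 * c + c\<^sup>2) * (s j)\<^sup>2" if "j < n" for j c
  proof -
    have "(\<Sum>k<m. w k * (sqrt (q k j) + c * s j)\<^sup>2)
        = (\<Sum>k<m. w k * q k j + 2 * c * s j * (w k * sqrt (q k j)) + c\<^sup>2 * (s j)\<^sup>2 * w k)"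
      by (rule sum.cong) (use pos[OF _ that] in \<open>auto simp: power2_sum power_mult_distrib algebra_simps less_imp_le\<close>)
    also have "\<dots> = qb j + 2 * c * s j * s j + c\<^sup>2 * (s j)\<^sup>2 * (\<Sum>k<m. w k)"
      by (simp add: sum.distrib qb_def s_def flip: sum_distrib_left)
    finally show ?thesis by (simp add: w power2_eq_square algebra_simps)
  qed
  have var: "(\<Sum>k<m. w k * (sqrt (q k j) - s j)\<^sup>2) = qb j - (s j)\<^sup>2" if "j < n" for j
    using expand[OF that, of "-1"] by simp
  have V: "V = 1 - (\<Sum>j<n. (s j)\<^sup>2)"
    unfolding V_def using var qb1 by (simp add: sum_subtractf)
  have W: "W = 1 + 3 * (\<Sum>j<n. (s j)\<^sup>2)"
    unfolding W_def using expand[of _ 1] qb1 by (simp add: sum.distrib flip: sum_distrib_left)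
  have V0: "0 \<le> V" unfolding V_def using w by (intro sum_nonneg mult_nonneg_nonneg) auto
  have V1: "V \<le> 1" unfolding V by (simp add: sum_nonneg)
  have W4: "W \<le> 4" using V W V0 by simp
  \<comment> \<open>Cauchy-Schwarz for the factorization of \<open>q k j - (s j)\<^sup>2\<close>
    into \<open>sqrt (q k j) - s j\<close> and \<open>sqrt (q k j) + s j\<close>, together with
    \<open>W \<le> 4\<close>.\<close>
  have cs: "(\<Sum>j<n. \<Sum>k<m. w k * \<bar>q k j - (s j)\<^sup>2\<bar>) \<le> 2 * sqrt V"
  proof -
    have "(\<Sum>j<n. \<Sum>k<m. w k * \<bar>q k j - (s j)\<^sup>2\<bar>)
        = (\<Sum>(j, k)\<in>I. (sqrt (w k) * \<bar>sqrt (q k j) - s j\<bar>) * (sqrt (w k) * (sqrt (q k j) + s j)))"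
      unfolding I_def sum.cartesian_product
    proof (intro sum.cong refl, clarsimp)
      fix j k assume jk: "j < n" "k < m"
      have "q k j - (s j)\<^sup>2 = (sqrt (q k j) - s j) * (sqrt (q k j) + s j)"
        using pos[OF jk(2,1)] by (simp add: algebra_simps power2_eq_square)
      moreover have "0 \<le> sqrt (q k j) + s j" using s0[OF jk(1)] pos[OF jk(2,1)] by simp
      ultimately have "\<bar>q k j - (s j)\<^sup>2\<bar> = \<bar>sqrt (q k j) - s j\<bar> * (sqrt (q k j) + s j)"
        by (simp add: abs_mult)
      moreover have "w k = sqrt (w k) * sqrt (w k)" using w(1)[OF jk(2)] by simp
      ultimately show "w k * \<bar>q k j - (s j)\<^sup>2\<bar>
          = sqrt (w k) * \<bar>sqrt (q k j) - s j\<bar> * (sqrt (w k) * (sqrt (q k j) + s j))"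
        by (metis mult.assoc mult.left_commute)
    qed
    also have "\<dots> \<le> sqrt (V * W)"
    proof (rule real_le_rsqrt)
      have "(\<Sum>(j, k)\<in>I. (sqrt (w k) * \<bar>sqrt (q k j) - s j\<bar>) * (sqrt (w k) * (sqrt (q k j) + s j)))\<^sup>2
          \<le> (\<Sum>(j, k)\<in>I. (sqrt (w k) * \<bar>sqrt (q k j) - s j\<bar>)\<^sup>2)
            * (\<Sum>(j, k)\<in>I. (sqrt (w k) * (sqrt (q k j) + s j))\<^sup>2)"
        using Cauchy_Schwarz_ineq_sum[of "\<lambda>(j, k). sqrt (w k) * \<bar>sqrt (q k j) - s j\<bar>"
            "\<lambda>(j, k). sqrt (w k) * (sqrt (q k j) + s j)" I]
        by (simp add: case_prod_unfold)
      also have "(\<Sum>(j, k)\<in>I. (sqrt (w k) * \<bar>sqrt (q k j) - s j\<bar>)\<^sup>2) = V"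
        unfolding V_def I_def sum.cartesian_product
        by (rule sum.cong) (auto simp: power_mult_distrib w)
      also have "(\<Sum>(j, k)\<in>I. (sqrt (w k) * (sqrt (q k j) + s j))\<^sup>2) = W"
        unfolding W_def I_def sum.cartesian_product
        by (rule sum.cong) (auto simp: power_mult_distrib w)
      finally show "(\<Sum>(j, k)\<in>I. (sqrt (w k) * \<bar>sqrt (q k j) - s j\<bar>) * (sqrt (w k) * (sqrt (q k j) + s j)))\<^sup>2
          \<le> V * W" .
    qed
    also have "\<dots> \<le> sqrt (V * 4)" using V0 W4 by (intro real_sqrt_le_mono mult_left_mono)
    finally show ?thesis by (simp add: real_sqrt_mult)
  qed
  define G where "G = (\<Sum>k<m. w k * (\<Sum>j<n. \<bar>q k j - qb j\<bar>))"
  have "G = (\<Sum>j<n. \<Sum>k<m. w k * \<bar>q k j - qb j\<bar>)"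
    unfolding G_def sum_distrib_left by (rule sum.swap)
  \<comment> \<open>Moving the centre from \<open>qb j\<close> to \<open>(s j)\<^sup>2\<close> costs
    the variance \<open>qb j - (s j)\<^sup>2\<close>; these variances sum to
    \<open>V\<close>.\<close>
  also have "\<dots> \<le> (\<Sum>j<n. \<Sum>k<m. w k * (\<bar>q k j - (s j)\<^sup>2\<bar> + (qb j - (s j)\<^sup>2)))"
  proof (intro sum_mono mult_left_mono)
    fix j k assume "j \<in> {..<n}" "k \<in> {..<m}"
    then have "0 \<le> qb j - (s j)\<^sup>2"
      by (subst var[symmetric]) (auto intro!: sum_nonneg mult_nonneg_nonneg w)
    then show "\<bar>q k j - qb j\<bar> \<le> \<bar>q k j - (s j)\<^sup>2\<bar> + (qb j - (s j)\<^sup>2)" by linarith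
  qed (use w in auto)
  also have "\<dots> = (\<Sum>j<n. \<Sum>k<m. w k * \<bar>q k j - (s j)\<^sup>2\<bar>) + (\<Sum>j<n. (qb j - (s j)\<^sup>2) * (\<Sum>k<m. w k))"
    by (simp add: distrib_left sum.distrib w flip: sum_distrib_right)
  also have "\<dots> \<le> 2 * sqrt V + V"
    using cs by (simp add: w V sum_subtractf qb1)
  \<comment> \<open>As \<open>V \<le> 1\<close>, it is at most its own square root. Squaring the
    factor 3 gives the constant 9.\<close>
  also have "\<dots> \<le> 3 * sqrt V"
  proof -
    have "V = sqrt V * sqrt V" using V0 by simp
    also have "\<dots> \<le> 1 * sqrt V" using V0 V1 by (intro mult_right_mono) auto
    finally show ?thesis by simp
  qed
  finally have "G \<le> 3 * sqrt V" .
  moreover have "0 \<le> G" unfolding G_def using w by (intro sum_nonneg mult_nonneg_nonneg) auto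
  ultimately have "G\<^sup>2 \<le> (3 * sqrt V)\<^sup>2" by (rule power_mono)
  then have GV: "G\<^sup>2 \<le> 9 * V" using V0 by (simp add: power_mult_distrib)
  have "(\<Sum>j<n. exp (\<Sum>k<m. w k * ln (q k j))) \<le> (\<Sum>j<n. (s j)\<^sup>2)"
  proof (rule sum_mono)
    fix j assume j: "j \<in> {..<n}"
    \<comment> \<open>The geometric mean is the square of the geometric mean of the square roots,
      whose arithmetic mean is \<open>s j\<close>.\<close>
    have "exp (\<Sum>k<m. w k * ln (q k j)) = (exp (\<Sum>k<m. w k * (ln (q k j) / 2)))\<^sup>2"
      by (simp add: power2_eq_square flip: exp_add sum.distrib)
    also have "\<dots> \<le> (\<Sum>k<m. w k * exp (ln (q k j) / 2))\<^sup>2"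
      by (intro power_mono exp_weighted_sum_le) (use w in auto)
    also have "(\<Sum>k<m. w k * exp (ln (q k j) / 2)) = s j"
      unfolding s_def
    proof (intro sum.cong refl)
      fix k assume "k \<in> {..<m}"
      then have "exp (ln (q k j) / 2) = sqrt (q k j)"
        using pos[of k j] j by (simp flip: ln_sqrt)
      then show "w k * exp (ln (q k j) / 2) = w k * sqrt (q k j)" by simp
    qed
    finally show "exp (\<Sum>k<m. w k * ln (q k j)) \<le> (s j)\<^sup>2" .
  qed
  then show ?thesis using GV V unfolding G_def qb_def by simp
qed

text \<open>
  After about \<open>11 R / \<epsilon>\<close> steps the quadratic recursion \<open>F k - F (k + 1) \<ge> (F k - F M)\<^sup>2 / (11 R\<^sup>2)\<close>
  has brought \<open>F k - F M\<close> below \<open>R \<epsilon>\<close>; from there on each step gains at least \<open>\<epsilon>\<^sup>2 / 11\<close>.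
\<close>

lemma descent_length_bound:
  fixes F g :: "nat \<Rightarrow> real"
  assumes eps: "0 < \<epsilon>" and M: "0 < M"
    and dec: "\<And>k. k < M \<Longrightarrow> (g k)\<^sup>2 \<le> 11 * (F k - F (Suc k))"
    and dual: "\<And>k. k < M \<Longrightarrow> F k - F M \<le> R * g k"
    and large: "\<And>k. k < M \<Longrightarrow> \<epsilon> < g k"
  shows "real M \<le> 1 + 22 * R / \<epsilon>"
proof -
  define d where "d k = F k - F M" for k
  have step: "\<epsilon>\<^sup>2 / 11 \<le> d k - d (Suc k)" if "k < M" for k
  proof -
    have "\<epsilon>\<^sup>2 \<le> (g k)\<^sup>2" using large[OF that] eps by (intro power_mono) auto
    then show ?thesis using dec[OF that] by (simp add: d_def)
  qed
  have lower: "real i * (\<epsilon>\<^sup>2 / 11) \<le> d (M - i)" if "i \<le> M" for i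
    using that
  proof (induction i)
    case (Suc i)
    then have "M - i = Suc (M - Suc i)" by simp
    then show ?case using Suc step[of "M - Suc i"] by (simp add: algebra_simps)
  qed (simp add: d_def)
  have dpos: "0 < d k" if "k < M" for k
  proof -
    have "0 < real (M - k) * (\<epsilon>\<^sup>2 / 11)" using that eps by simp
    then show ?thesis using lower[of "M - k"] that by simp
  qed
  have "0 < R * g 0" using dual[OF M] dpos[OF M] by (simp add: d_def)
  then have R: "0 < R" using large[OF M] eps by (simp add: zero_less_mult_iff)
  \<comment> \<open>The usual growth of \<open>1 / d k\<close> by at least
    \<open>1 / (11 * R\<^sup>2)\<close> per step, multiplied out so that no reciprocals
    occur.\<close>
  have upper: "real k * d k \<le> 11 * R\<^sup>2" if "k < M" for k
    using that
  proof (induction k)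
    case (Suc k)
    have k: "k < M" using Suc by simp
    have dd: "d (Suc k) \<le> d k" using step[OF k] eps by (smt (verit) zero_le_power divide_nonneg_nonneg)
    have "(d k)\<^sup>2 \<le> (R * g k)\<^sup>2"
      using dual[OF k] dpos[OF k] by (intro power_mono) (auto simp: d_def)
    also have "\<dots> \<le> R\<^sup>2 * (11 * (d k - d (Suc k)))"
      using dec[OF k] by (simp add: power_mult_distrib d_def mult_left_mono)
    finally have rec: "(d k)\<^sup>2 \<le> 11 * R\<^sup>2 * (d k - d (Suc k))" by (simp add: algebra_simps)
    have "real k * d k * d (Suc k) \<le> 11 * R\<^sup>2 * d (Suc k)"
      using Suc.IH[OF k] dpos[OF Suc.prems] by (intro mult_right_mono) auto
    moreover have "d k * d (Suc k) \<le> (d k)\<^sup>2"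
      using dd dpos[OF k] by (simp add: power2_eq_square mult_left_mono)
    ultimately have "d k * (real (Suc k) * d (Suc k)) \<le> d k * (11 * R\<^sup>2)"
      using rec by (simp add: algebra_simps)
    then show ?case using dpos[OF k] by simp
  qed simp
  \<comment> \<open>Rounding the switching index up accounts for the summand 1 in the bound; each of
    the two phases contributes \<open>11 * R / \<epsilon>\<close>.\<close>
  define j where "j = nat \<lceil>11 * R / \<epsilon>\<rceil>"
  have Re: "0 < 11 * R / \<epsilon>" using R eps by simp
  have j1: "11 * R / \<epsilon> \<le> real j" "real j \<le> 1 + 11 * R / \<epsilon>"
    unfolding j_def using Re by linarith+
  show ?thesis
  proof (cases "M \<le> j")
    case True
    then have "real M \<le> real j" by simp
    then show ?thesis using j1 Re by (simp add: field_simps)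
  next
    case False
    then have j: "j < M" by simp
    have "11 * R / \<epsilon> * d j \<le> real j * d j" using j1 dpos[OF j] by (intro mult_right_mono) auto
    also have "\<dots> \<le> 11 * R\<^sup>2" by (rule upper[OF j])
    finally have "d j \<le> R * \<epsilon>" using R eps by (simp add: field_simps power2_eq_square)
    moreover have "(real M - real j) * (\<epsilon>\<^sup>2 / 11) \<le> d j"
      using lower[of "M - j"] j by (simp add: of_nat_diff)
    ultimately have "\<epsilon> * ((real M - real j) * \<epsilon>) \<le> \<epsilon> * (11 * R)"
      by (simp add: power2_eq_square mult_ac)
    then have "real M - real j \<le> 11 * R / \<epsilon>"
      using eps by (simp add: pos_le_divide_eq)
    then show ?thesis using j1 by simp
  qed
qed

section \<open>The iteration\<close>

locale barycenter_problem =
  fixes m n :: nat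
    and p :: "nat \<Rightarrow> nat \<Rightarrow> real"
    and C :: "nat \<Rightarrow> nat \<Rightarrow> nat \<Rightarrow> real"
    and w :: "nat \<Rightarrow> real"
    and \<gamma> :: real
  assumes data: "barycenter_data m n p C w \<gamma>"
begin

section \<open>Real-valued description of the iterates after whole rounds\<close>

abbreviation K :: "nat \<Rightarrow> nat \<Rightarrow> nat \<Rightarrow> real" where
  "K l \<equiv> kernel \<gamma> (C l)"

text \<open>After a round, \<open>u\<close> is \<open>-\<infinity>\<close> wherever \<open>p\<close>
  vanishes, so it is kept through its exponential. In contrast \<open>v\<close> is finite for every
  \<open>l < m\<close> and is kept itself.\<close>

definition a :: "nat \<Rightarrow> nat \<Rightarrow> nat \<Rightarrow> real" where
  "a k l i = exp_ext (fst (dibp m n p C w \<gamma> (2 * k)) l i)"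

definition v :: "nat \<Rightarrow> nat \<Rightarrow> nat \<Rightarrow> real" where
  "v k l j = real_of_ereal (snd (dibp m n p C w \<gamma> (2 * k)) l j)"

definition Ka :: "nat \<Rightarrow> nat \<Rightarrow> nat \<Rightarrow> real" where
  "Ka k l j = (\<Sum>i<n. K l i j * a k l i)"

definition Kb :: "nat \<Rightarrow> nat \<Rightarrow> nat \<Rightarrow> real" where
  "Kb k l i = (\<Sum>j<n. K l i j * exp (v k l j))"

definition B :: "nat \<Rightarrow> nat \<Rightarrow> nat \<Rightarrow> nat \<Rightarrow> real" where
  "B k l i j = a k l i * K l i j * exp (v k l j)"

definition q :: "nat \<Rightarrow> nat \<Rightarrow> nat \<Rightarrow> real" where
  "q k l j = (\<Sum>i<n. B k l i j)"

definition gap :: "nat \<Rightarrow> real" where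
  "gap k = (\<Sum>l<m. w l * (\<Sum>j<n. \<bar>q k l j - (\<Sum>l'<m. w l' * q k l' j)\<bar>))"

text \<open>
  Up to an additive constant, the dual objective at the iterate with counter \<open>2 k\<close>.  Where
  \<open>u = -\<infinity>\<close> the entry of \<open>p\<close> vanishes, so the junk value \<open>ln 0\<close> does not contribute.
\<close>

definition dual_value :: "nat \<Rightarrow> real" where
  "dual_value k = - (\<Sum>l<m. w l * (\<Sum>i<n. p l i * ln (a k l i)))"

text \<open>For \<open>l < m\<close> the entries of \<open>K l\<close> lie between
  \<open>exp (- c l)\<close> and \<open>1\<close>; thus \<open>c l\<close> controls the oscillation
  of logarithms of its column sums.\<close>

definition c :: "nat \<Rightarrow> real" where
  "c l = max_entry n (C l) / \<gamma>"

lemma m_pos: "0 < m" and n_pos: "0 < n" and gamma_pos: "0 < \<gamma>" and w_sum: "(\<Sum>l<m. w l) = 1"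
  using data by (auto simp: barycenter_data_def)

lemma w_nonneg: "l < m \<Longrightarrow> 0 \<le> w l"
  using data by (auto simp: barycenter_data_def)

lemma p_nonneg: "l < m \<Longrightarrow> i < n \<Longrightarrow> 0 \<le> p l i"
  using data by (auto simp: barycenter_data_def prob_simplex_def)

lemma p_sum: "l < m \<Longrightarrow> (\<Sum>i<n. p l i) = 1"
  using data by (auto simp: barycenter_data_def prob_simplex_def)

lemma C_nonneg: "l < m \<Longrightarrow> i < n \<Longrightarrow> j < n \<Longrightarrow> 0 \<le> C l i j"
  using data by (auto simp: barycenter_data_def)

lemma C_le_max_entry: "i < n \<Longrightarrow> j < n \<Longrightarrow> C l i j \<le> max_entry n (C l)"
  unfolding max_entry_def by (rule Max_ge) force+

lemma K_pos: "0 < K l i j"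
  by (simp add: kernel_def)

lemma Kb_pos: "0 < Kb k l i"
  unfolding Kb_def using n_pos by (intro sum_pos) (auto simp: K_pos)

section \<open>One round in real arithmetic\<close>

lemma dibp_even_Suc:
  "dibp m n p C w \<gamma> (2 * Suc k) =
     (u_step n p C \<gamma> (v_step m n C w \<gamma> (fst (dibp m n p C w \<gamma> (2 * k)))),
      v_step m n C w \<gamma> (fst (dibp m n p C w \<gamma> (2 * k))))"
  by (simp add: case_prod_unfold)

text \<open>Positivity of \<open>Ka\<close> makes the extended logarithms finite. It is a hypothesis
  here because the induction \<open>a_nonneg_nonzero\<close> that yields it relies on the formulas
  for one round.\<close>

lemma snd_dibp_Suc:
  assumes "\<And>l. l < m \<Longrightarrow> 0 < Ka k l j" and "l < m"
  shows "snd (dibp m n p C w \<gamma> (2 * Suc k)) l j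
           = ereal ((\<Sum>l'<m. w l' * ln (Ka k l' j)) - ln (Ka k l j))"
proof -
  have eq: "mat_vec n (mat_transpose (K l)) (\<lambda>i. exp_ext (fst (dibp m n p C w \<gamma> (2 * k)) l i)) j
      = Ka k l j" for l
    by (simp add: mat_vec_def mat_transpose_def Ka_def a_def)
  have ln: "ln_ext (Ka k l j) = ereal (ln (Ka k l j))" if "l < m" for l
    using assms(1)[OF that] by (simp add: ln_ext_def)
  show ?thesis
    unfolding dibp_even_Suc snd_conv v_step_def eq using assms(2) by (simp add: ln)
qed

lemma fst_dibp_Suc:
  assumes "\<And>l j. l < m \<Longrightarrow> j < n \<Longrightarrow> 0 < Ka k l j" and "l < m"
  shows "fst (dibp m n p C w \<gamma> (2 * Suc k)) l i = ln_ext (p l i) - ereal (ln (Kb (Suc k) l i))"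
proof -
  have "exp_ext (snd (dibp m n p C w \<gamma> (2 * Suc k)) l j) = exp (v (Suc k) l j)" if "j < n" for j
    unfolding v_def using snd_dibp_Suc[of k j l] assms that by (simp add: exp_ext_def)
  then have "mat_vec n (K l) (\<lambda>j. exp_ext (snd (dibp m n p C w \<gamma> (2 * Suc k)) l j)) i = Kb (Suc k) l i"
    by (simp add: mat_vec_def Kb_def)
  then show ?thesis
    using Kb_pos[of "Suc k" l i] unfolding dibp_even_Suc fst_conv snd_conv u_step_def
    by (simp add: ln_ext_def)
qed

text \<open>Where \<open>p l i = 0\<close>, subtracting a finite logarithm from
  \<open>-\<infinity>\<close> leaves \<open>-\<infinity>\<close>, and both sides are zero.\<close>

lemma a_Suc_aux:
  assumes "\<And>l j. l < m \<Longrightarrow> j < n \<Longrightarrow> 0 < Ka k l j" and "l < m" and "i < n"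
  shows "a (Suc k) l i = p l i / Kb (Suc k) l i"
  using p_nonneg[OF assms(2,3)] Kb_pos[of "Suc k" l i]
  by (auto simp: a_def fst_dibp_Suc[OF assms(1,2)] ln_ext_def exp_ext_def exp_diff
      simp del: dibp.simps mult_Suc_right)

text \<open>One positive entry suffices for \<open>Ka\<close> to be positive, since the kernel is.
  The entry persists because \<open>p l\<close> has mass one and the new \<open>a\<close> is
  \<open>p\<close> divided by positive numbers.\<close>

lemma a_nonneg_nonzero:
  "l < m \<Longrightarrow> (\<forall>i<n. 0 \<le> a k l i) \<and> (\<exists>i<n. 0 < a k l i)"
proof (induction k arbitrary: l)
  case 0
  then show ?case using n_pos by (auto simp: a_def exp_ext_def)
next
  case (Suc k)
  have "0 < Ka k l j" if "l < m" "j < n" for l j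
  proof -
    from Suc.IH[OF that(1)] obtain i where "i < n" "0 < a k l i" by blast
    then show ?thesis
      unfolding Ka_def using Suc.IH[OF that(1)] K_pos
      by (intro sum_pos2[of _ i]) (auto intro!: mult_nonneg_nonneg less_imp_le[OF K_pos])
  qed
  then have eq: "a (Suc k) l i = p l i / Kb (Suc k) l i" if "i < n" for i
    using a_Suc_aux Suc.prems that by blast
  have "\<exists>i<n. p l i \<noteq> 0"
  proof (rule ccontr)
    assume "\<not> ?thesis"
    then have "(\<Sum>i<n. p l i) = 0" by (intro sum.neutral) auto
    then show False using p_sum[OF Suc.prems] by simp
  qed
  then obtain i where "i < n" "0 < p l i" using p_nonneg[OF Suc.prems] by force
  then show ?case
    using eq Kb_pos p_nonneg[OF Suc.prems] by (auto intro!: divide_nonneg_pos exI[of _ i])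
qed

lemma a_nonneg: "l < m \<Longrightarrow> i < n \<Longrightarrow> 0 \<le> a k l i"
  using a_nonneg_nonzero by blast

lemma Ka_pos: "l < m \<Longrightarrow> 0 < Ka k l j"
proof -
  assume l: "l < m"
  then obtain i where "i < n" "0 < a k l i" using a_nonneg_nonzero by blast
  then show ?thesis
    unfolding Ka_def using a_nonneg[OF l] K_pos
    by (intro sum_pos2[of _ i]) (auto intro!: mult_nonneg_nonneg less_imp_le[OF K_pos])
qed

lemma v_Suc: "l < m \<Longrightarrow> v (Suc k) l j = (\<Sum>l'<m. w l' * ln (Ka k l' j)) - ln (Ka k l j)"
  unfolding v_def using snd_dibp_Suc[of k j l] Ka_pos by simp

lemma a_Suc: "l < m \<Longrightarrow> i < n \<Longrightarrow> a (Suc k) l i = p l i / Kb (Suc k) l i"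
  using a_Suc_aux Ka_pos by blast

lemma a_Suc_pos_iff: "l < m \<Longrightarrow> i < n \<Longrightarrow> 0 < a (Suc k) l i \<longleftrightarrow> 0 < p l i"
  using Kb_pos[of "Suc k" l i] by (simp add: a_Suc zero_less_divide_iff)

lemma a_Suc_eq_0: "l < m \<Longrightarrow> i < n \<Longrightarrow> p l i = 0 \<Longrightarrow> a (Suc k) l i = 0"
  by (simp add: a_Suc)

section \<open>Plans and their marginals\<close>

lemma dibp_plan_eq: "l < m \<Longrightarrow> dibp_plan m n p C w \<gamma> (2 * k) l i j = B k l i j"
proof -
  assume "l < m"
  then have "exp_ext (snd (dibp m n p C w \<gamma> (2 * k)) l j) = exp (v k l j)"
    by (cases k) (auto simp: v_def exp_ext_def snd_dibp_Suc Ka_pos simp del: mult_Suc_right)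
  then show ?thesis
    by (simp add: dibp_plan_def case_prod_unfold scaled_kernel_def B_def a_def)
qed

lemma marginal_gap_eq: "marginal_gap m n w (dibp_plan m n p C w \<gamma> (2 * k)) = gap k"
  by (simp add: marginal_gap_def mean_marginal_def l1_norm_def gap_def q_def mat_vec_def
      mat_transpose_def ones_def dibp_plan_eq cong: sum.cong_simp)

lemma objective_dibp_plan:
  "objective m n C w \<gamma> (dibp_plan m n p C w \<gamma> (2 * k)) = objective m n C w \<gamma> (B k)"
  by (simp add: objective_def frob_def entropy_def dibp_plan_eq cong: sum.cong_simp)

lemma B_nonneg: "l < m \<Longrightarrow> i < n \<Longrightarrow> 0 \<le> B k l i j"
  unfolding B_def by (intro mult_nonneg_nonneg a_nonneg less_imp_le[OF K_pos]) auto

lemma q_eq: "q k l j = Ka k l j * exp (v k l j)"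
  unfolding q_def B_def Ka_def sum_distrib_right by (intro sum.cong) (auto simp: mult_ac)

lemma q_pos: "l < m \<Longrightarrow> 0 < q k l j"
  by (simp add: q_eq Ka_pos)

text \<open>The closing \<open>u\<close>-step of a round divides by \<open>Kb\<close>, which cancels
  here. \<open>Suc\<close> matters: \<open>B 0\<close> is the bare kernel.\<close>

lemma B_row_sum:
  assumes "l < m" "i < n"
  shows "(\<Sum>j<n. B (Suc k) l i j) = p l i"
proof -
  have "(\<Sum>j<n. B (Suc k) l i j) = a (Suc k) l i * Kb (Suc k) l i"
    by (simp add: B_def Kb_def sum_distrib_left mult_ac)
  then show ?thesis using Kb_pos[of "Suc k" l i] by (simp add: a_Suc assms)
qed

lemma q_sum: "l < m \<Longrightarrow> (\<Sum>j<n. q (Suc k) l j) = 1"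
  unfolding q_def by (subst sum.swap) (simp add: B_row_sum p_sum)

text \<open>The \<open>v\<close>-step subtracts each \<open>ln (Ka k l j)\<close> from their
  weighted mean over \<open>l\<close>; initially \<open>v\<close> is zero.\<close>

lemma v_weighted_sum: "(\<Sum>l<m. w l * v k l j) = 0"
proof (cases k)
  case (Suc k')
  have "(\<Sum>l<m. w l * v (Suc k') l j)
      = (\<Sum>l<m. w l * (\<Sum>l'<m. w l' * ln (Ka k' l' j)) - w l * ln (Ka k' l j))"
    by (simp add: v_Suc right_diff_distrib)
  then show ?thesis
    by (simp add: Suc sum_subtractf w_sum flip: sum_distrib_right)
qed (simp add: v_def)

section \<open>Oscillation of the \<open>v\<close>-variables\<close>

lemma c_nonneg: "l < m \<Longrightarrow> 0 \<le> c l"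
  unfolding c_def using C_nonneg[of l 0 0] C_le_max_entry[of 0 0 l] n_pos gamma_pos by simp

text \<open>Two entries in the same row of \<open>K l\<close> differ by a factor of at most
  \<open>exp (c l)\<close>, because the costs lie between zero and their maximum. The factor
  survives summation with the weights \<open>a\<close>.\<close>

lemma ln_Ka_osc:
  assumes "l < m" "j < n" "j' < n"
  shows "ln (Ka k l j) - ln (Ka k l j') \<le> c l"
proof -
  have "K l i j \<le> exp (c l) * K l i j'" if "i < n" for i
  proof -
    have "C l i j' / \<gamma> \<le> c l" unfolding c_def
      using C_le_max_entry[OF that assms(3)] gamma_pos by (simp add: divide_right_mono)
    moreover have "0 \<le> C l i j / \<gamma>" using C_nonneg[OF assms(1) that assms(2)] gamma_pos by simp
    ultimately show ?thesis by (simp add: kernel_def flip: exp_add)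
  qed
  then have "Ka k l j \<le> exp (c l) * Ka k l j'"
    unfolding Ka_def sum_distrib_left using a_nonneg[OF assms(1)]
    by (intro sum_mono) (auto simp: mult_right_mono simp flip: mult.assoc)
  then have "ln (Ka k l j) \<le> ln (exp (c l) * Ka k l j')"
    using Ka_pos[OF assms(1)] by (simp add: ln_le_cancel_iff)
  then show ?thesis using Ka_pos[OF assms(1), of k j'] by (simp add: ln_mult)
qed

text \<open>The two parts of the bound come from the plan's own logarithm, with \<open>j\<close> and
  \<open>j'\<close> exchanged, and from the weighted mean of all logarithms.\<close>

lemma v_osc:
  assumes "l < m" "j < n" "j' < n"
  shows "v (Suc k) l j - v (Suc k) l j' \<le> c l + (\<Sum>l'<m. w l' * c l')"
proof -
  have "(\<Sum>l'<m. w l' * ln (Ka k l' j)) - (\<Sum>l'<m. w l' * ln (Ka k l' j'))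
      = (\<Sum>l'<m. w l' * (ln (Ka k l' j) - ln (Ka k l' j')))"
    by (simp add: right_diff_distrib sum_subtractf)
  also have "\<dots> \<le> (\<Sum>l'<m. w l' * c l')"
    by (intro sum_mono mult_left_mono) (auto intro: ln_Ka_osc w_nonneg assms)
  finally show ?thesis using ln_Ka_osc[OF assms(1,3,2), of k] by (simp add: v_Suc assms(1))
qed

section \<open>Convexity estimates and dual descent\<close>

text \<open>Nonnegativity of the divergence of \<open>\<pi>\<close> from \<open>B (Suc k) l\<close>,
  with \<open>ln B\<close> expanded as \<open>ln a - C / \<gamma> + v\<close>; the masses cancel
  since both have row sums \<open>p l\<close>. It serves for plans of another round and for feasible
  plans.\<close>

lemma gibbs_plan:
  assumes l: "l < m" and nonneg: "\<And>i j. i < n \<Longrightarrow> j < n \<Longrightarrow> 0 \<le> \<pi> i j"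
    and row: "\<And>i. i < n \<Longrightarrow> (\<Sum>j<n. \<pi> i j) = p l i"
  shows "(\<Sum>i<n. p l i * ln (a (Suc k) l i)) + (\<Sum>j<n. (\<Sum>i<n. \<pi> i j) * v (Suc k) l j)
           \<le> (\<Sum>i<n. \<Sum>j<n. \<pi> i j * (ln (\<pi> i j) + C l i j / \<gamma>))"
proof -
  \<comment> \<open>In rows where \<open>p\<close> vanishes both plans are zero, so the junk value
    \<open>ln 0\<close> is always multiplied by zero.\<close>
  have zero: "\<pi> i j = 0" if "i < n" "j < n" "p l i = 0" for i j
    using row[OF that(1)] nonneg[OF that(1)] that(2,3)
    by (metis finite_lessThan lessThan_iff sum_nonneg_eq_0_iff)
  have entry: "\<pi> i j - B (Suc k) l i j
      \<le> \<pi> i j * (ln (\<pi> i j) + C l i j / \<gamma>) - \<pi> i j * ln (a (Suc k) l i) - \<pi> i j * v (Suc k) l j"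
    if ij: "i < n" "j < n" for i j
  proof (cases "p l i = 0")
    case True
    then show ?thesis using zero[OF ij] a_Suc_eq_0[OF l ij(1)] by (simp add: B_def)
  next
    case False
    then have apos: "0 < a (Suc k) l i" using p_nonneg[OF l ij(1)] a_Suc_pos_iff[OF l ij(1)] by simp
    then have "0 < B (Suc k) l i j" by (simp add: B_def K_pos)
    then have "\<pi> i j - B (Suc k) l i j \<le> \<pi> i j * (ln (\<pi> i j) - ln (B (Suc k) l i j))"
      by (intro diff_le_mult_ln_diff nonneg ij)
    also have "ln (B (Suc k) l i j) = ln (a (Suc k) l i) - C l i j / \<gamma> + v (Suc k) l j"
      using apos by (simp add: B_def kernel_def ln_mult)
    finally show ?thesis by (simp add: algebra_simps)
  qed
  have "0 = (\<Sum>i<n. \<Sum>j<n. \<pi> i j - B (Suc k) l i j)"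
    by (simp add: sum_subtractf row B_row_sum l)
  also have "\<dots> \<le> (\<Sum>i<n. \<Sum>j<n. \<pi> i j * (ln (\<pi> i j) + C l i j / \<gamma>)
      - \<pi> i j * ln (a (Suc k) l i) - \<pi> i j * v (Suc k) l j)"
    by (intro sum_mono entry) auto
  also have "\<dots> = (\<Sum>i<n. \<Sum>j<n. \<pi> i j * (ln (\<pi> i j) + C l i j / \<gamma>))
      - (\<Sum>i<n. p l i * ln (a (Suc k) l i)) - (\<Sum>i<n. \<Sum>j<n. \<pi> i j * v (Suc k) l j)"
    by (simp add: sum_subtractf row flip: sum_distrib_right)
  also have "(\<Sum>i<n. \<Sum>j<n. \<pi> i j * v (Suc k) l j) = (\<Sum>j<n. (\<Sum>i<n. \<pi> i j) * v (Suc k) l j)"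
    unfolding sum_distrib_right by (rule sum.swap)
  finally show ?thesis by simp
qed

text \<open>The equality case of \<open>gibbs_plan\<close>, where the divergence is zero.\<close>

lemma gibbs_plan_eq:
  assumes l: "l < m"
  shows "(\<Sum>i<n. \<Sum>j<n. B (Suc k) l i j * (ln (B (Suc k) l i j) + C l i j / \<gamma>))
           = (\<Sum>i<n. p l i * ln (a (Suc k) l i)) + (\<Sum>j<n. q (Suc k) l j * v (Suc k) l j)"
proof -
  have entry: "B (Suc k) l i j * (ln (B (Suc k) l i j) + C l i j / \<gamma>)
      = B (Suc k) l i j * ln (a (Suc k) l i) + B (Suc k) l i j * v (Suc k) l j" if "i < n" for i j
  proof (cases "p l i = 0")
    case True
    then show ?thesis using a_Suc_eq_0[OF l that] by (simp add: B_def)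
  next
    case False
    then have apos: "0 < a (Suc k) l i" using p_nonneg[OF l that] a_Suc_pos_iff[OF l that] by simp
    have "ln (B (Suc k) l i j) + C l i j / \<gamma> = ln (a (Suc k) l i) + v (Suc k) l j"
      using apos by (simp add: B_def kernel_def ln_mult)
    then show ?thesis by (simp only: distrib_left)
  qed
  have "(\<Sum>i<n. \<Sum>j<n. B (Suc k) l i j * (ln (B (Suc k) l i j) + C l i j / \<gamma>))
      = (\<Sum>i<n. p l i * ln (a (Suc k) l i)) + (\<Sum>i<n. \<Sum>j<n. B (Suc k) l i j * v (Suc k) l j)"
    by (simp add: entry sum.distrib B_row_sum l flip: sum_distrib_right)
  also have "(\<Sum>i<n. \<Sum>j<n. B (Suc k) l i j * v (Suc k) l j) = (\<Sum>j<n. q (Suc k) l j * v (Suc k) l j)"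
    unfolding q_def sum_distrib_right by (rule sum.swap)
  finally show ?thesis .
qed

text \<open>
  Vectors \<open>y l\<close> with vanishing weighted mean do not see the common part of the marginals, so the
  marginals may be centred; since these have mass one, only the oscillation of \<open>y l\<close> matters.
\<close>

lemma weighted_inner_le_gap:
  assumes mean: "\<And>j. j < n \<Longrightarrow> (\<Sum>l<m. w l * y l j) = 0"
    and osc: "\<And>l i j. l < m \<Longrightarrow> i < n \<Longrightarrow> j < n \<Longrightarrow> y l i - y l j \<le> 2 * R"
  shows "(\<Sum>l<m. w l * (\<Sum>j<n. q (Suc k) l j * y l j)) \<le> R * gap (Suc k)"
proof -
  define qb where "qb j = (\<Sum>l<m. w l * q (Suc k) l j)" for j
  have qb: "(\<Sum>j<n. qb j) = 1"
    unfolding qb_def by (subst sum.swap) (simp add: q_sum w_sum flip: sum_distrib_left)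
  have "(\<Sum>l<m. w l * (\<Sum>j<n. qb j * y l j)) = (\<Sum>j<n. qb j * (\<Sum>l<m. w l * y l j))"
    unfolding sum_distrib_left by (subst sum.swap) (simp add: mult_ac)
  also have "\<dots> = 0" by (simp add: mean)
  finally have "(\<Sum>l<m. w l * (\<Sum>j<n. q (Suc k) l j * y l j))
      = (\<Sum>l<m. w l * (\<Sum>j<n. (q (Suc k) l j - qb j) * y l j))"
    by (simp add: left_diff_distrib right_diff_distrib sum_subtractf)
  also have "\<dots> \<le> (\<Sum>l<m. w l * (R * (\<Sum>j<n. \<bar>q (Suc k) l j - qb j\<bar>)))"
    by (intro sum_mono mult_left_mono sum_mult_le_oscillation)
      (auto intro: osc w_nonneg simp: sum_subtractf q_sum qb)
  finally show ?thesis
    by (simp add: gap_def qb_def sum_distrib_left mult_ac)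
qed

text \<open>Measuring \<open>B (Suc k)\<close> against the potentials of round \<open>Suc k'\<close>
  gives an inequality, against its own an equality. Their difference leaves only the marginals
  paired with the change of \<open>v\<close>.\<close>

lemma dual_value_diff_le:
  assumes "\<And>l. l < m \<Longrightarrow> c l + (\<Sum>l'<m. w l' * c l') \<le> R"
  shows "dual_value (Suc k) - dual_value (Suc k') \<le> R * gap (Suc k)"
proof -
  have "dual_value (Suc k) - dual_value (Suc k')
      = (\<Sum>l<m. w l * ((\<Sum>i<n. p l i * ln (a (Suc k') l i)) - (\<Sum>i<n. p l i * ln (a (Suc k) l i))))"
    by (simp add: dual_value_def right_diff_distrib sum_subtractf)
  also have "\<dots> \<le> (\<Sum>l<m. w l * (\<Sum>j<n. q (Suc k) l j * (v (Suc k) l j - v (Suc k') l j)))"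
  proof (intro sum_mono mult_left_mono)
    fix l assume "l \<in> {..<m}"
    then have l: "l < m" by simp
    show "(\<Sum>i<n. p l i * ln (a (Suc k') l i)) - (\<Sum>i<n. p l i * ln (a (Suc k) l i))
        \<le> (\<Sum>j<n. q (Suc k) l j * (v (Suc k) l j - v (Suc k') l j))"
      using gibbs_plan[OF l, of "B (Suc k) l" k'] gibbs_plan_eq[OF l, of k]
      by (simp add: B_nonneg B_row_sum l right_diff_distrib sum_subtractf flip: q_def)
  qed (auto intro: w_nonneg)
  also have "\<dots> \<le> R * gap (Suc k)"
  proof (rule weighted_inner_le_gap)
    show "(\<Sum>l<m. w l * (v (Suc k) l j - v (Suc k') l j)) = 0" for j
      by (simp add: right_diff_distrib sum_subtractf v_weighted_sum)
    show "v (Suc k) l i - v (Suc k') l i - (v (Suc k) l j - v (Suc k') l j) \<le> 2 * R"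
      if "l < m" "i < n" "j < n" for l i j
      \<comment> \<open>Each of the two \<open>v\<close> oscillates by at most \<open>R\<close>,
        their difference by at most \<open>2 * R\<close>.\<close>
      using v_osc[OF that, of k] v_osc[OF that(1,3,2), of k'] assms[OF that(1)] by linarith
  qed
  finally show ?thesis .
qed

text \<open>After the \<open>v\<close>-step every intermediate plan has mass \<open>S\<close>, the
  mass of the geometric mean of the old marginals. The \<open>u\<close>-step rescales its rows from
  \<open>r\<close> to \<open>p\<close>, gaining the sum of \<open>p * ln (p / r)\<close>, which is
  at least \<open>1 - S\<close>.\<close>

lemma gap_sq_le_descent: "(gap (Suc k))\<^sup>2 \<le> 9 * (dual_value (Suc k) - dual_value (Suc (Suc k)))"
proof -
  define S where "S = (\<Sum>j<n. exp (\<Sum>l<m. w l * ln (q (Suc k) l j)))"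
  \<comment> \<open>The factors \<open>exp v\<close> drop out of the geometric mean since the
    weighted mean of \<open>v\<close> is zero.\<close>
  have geo: "(\<Sum>l<m. w l * ln (q (Suc k) l j)) = (\<Sum>l<m. w l * ln (Ka (Suc k) l j))" for j
  proof -
    have "(\<Sum>l<m. w l * ln (q (Suc k) l j)) = (\<Sum>l<m. w l * ln (Ka (Suc k) l j) + w l * v (Suc k) l j)"
      by (rule sum.cong) (use Ka_pos in \<open>auto simp: q_eq ln_mult less_imp_neq[symmetric] distrib_left\<close>)
    then show ?thesis by (simp add: sum.distrib v_weighted_sum)
  qed
  have KaS: "(\<Sum>j<n. Ka (Suc k) l j * exp (v (Suc (Suc k)) l j)) = S" if "l < m" for l
    unfolding S_def geo using Ka_pos[OF that] by (intro sum.cong) (simp_all add: v_Suc that exp_diff less_imp_neq[symmetric])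
  have "1 - S = (\<Sum>l<m. w l * (1 - S))"
    by (simp add: w_sum flip: sum_distrib_right)
  also have "\<dots> \<le> (\<Sum>l<m. w l * ((\<Sum>i<n. p l i * ln (a (Suc (Suc k)) l i)) - (\<Sum>i<n. p l i * ln (a (Suc k) l i))))"
  proof (intro sum_mono mult_left_mono)
    fix l assume "l \<in> {..<m}"
    then have l: "l < m" by simp
    \<comment> \<open>The row sums of the plan between the \<open>v\<close>-step and the
      \<open>u\<close>-step.\<close>
    define r where "r i = a (Suc k) l i * Kb (Suc (Suc k)) l i" for i
    have "(\<Sum>i<n. r i) = (\<Sum>i<n. \<Sum>j<n. a (Suc k) l i * K l i j * exp (v (Suc (Suc k)) l j))"
      by (simp add: r_def Kb_def sum_distrib_left mult_ac)
    also have "\<dots> = (\<Sum>j<n. Ka (Suc k) l j * exp (v (Suc (Suc k)) l j))"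
      unfolding Ka_def sum_distrib_right by (subst sum.swap) (simp add: mult_ac)
    finally have rS: "(\<Sum>i<n. r i) = S" by (simp add: KaS l)
    have "1 - S = (\<Sum>i<n. p l i - r i)" by (simp add: sum_subtractf p_sum l rS)
    also have "\<dots> \<le> (\<Sum>i<n. p l i * ln (a (Suc (Suc k)) l i) - p l i * ln (a (Suc k) l i))"
    proof (rule sum_mono)
      fix i assume "i \<in> {..<n}"
      then have i: "i < n" by simp
      show "p l i - r i \<le> p l i * ln (a (Suc (Suc k)) l i) - p l i * ln (a (Suc k) l i)"
      proof (cases "p l i = 0")
        case True
        then show ?thesis using a_Suc_eq_0[OF l i] by (simp add: r_def)
      next
        case False
        then have pp: "0 < p l i" using p_nonneg[OF l i] by simp
        then have ap: "0 < a (Suc k) l i" using a_Suc_pos_iff[OF l i] by simp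
        have kp: "0 < Kb (Suc (Suc k)) l i" by (rule Kb_pos)
        have "ln (a (Suc (Suc k)) l i) - ln (a (Suc k) l i) = ln (p l i) - ln (r i)"
          unfolding a_Suc[OF l i, of "Suc k"] r_def using pp ap kp by (simp add: ln_div ln_mult)
        moreover have "p l i - r i \<le> p l i * (ln (p l i) - ln (r i))"
          using pp ap kp by (intro diff_le_mult_ln_diff) (auto simp: r_def)
        ultimately show ?thesis by (simp flip: right_diff_distrib)
      qed
    qed
    finally show "1 - S \<le> (\<Sum>i<n. p l i * ln (a (Suc (Suc k)) l i)) - (\<Sum>i<n. p l i * ln (a (Suc k) l i))"
      by (simp add: sum_subtractf)
  qed (auto intro: w_nonneg)
  also have "\<dots> = dual_value (Suc k) - dual_value (Suc (Suc k))"
    by (simp add: dual_value_def right_diff_distrib sum_subtractf)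
  finally have "1 - S \<le> dual_value (Suc k) - dual_value (Suc (Suc k))" .
  moreover have "(gap (Suc k))\<^sup>2 \<le> 9 * (1 - S)"
    unfolding gap_def S_def
    by (rule l1_deviation_le_geometric_mean_deficit) (auto intro: w_nonneg w_sum q_pos q_sum)
  ultimately show ?thesis by simp
qed

section \<open>The regularized objective\<close>

text \<open>The \<open>- 1\<close> in the entropy contributes the total mass, which is one. Hence
  differences of objectives reduce to the functional in \<open>gibbs_plan\<close>.\<close>

lemma objective_summand_eq:
  assumes "l < m" "\<And>i. i < n \<Longrightarrow> (\<Sum>j<n. \<pi> i j) = p l i"
  shows "frob n (C l) \<pi> + \<gamma> * entropy n \<pi>
           = \<gamma> * ((\<Sum>i<n. \<Sum>j<n. \<pi> i j * (ln (\<pi> i j) + C l i j / \<gamma>)) - 1)"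
proof -
  have "frob n (C l) \<pi> + \<gamma> * entropy n \<pi>
      = (\<Sum>i<n. \<Sum>j<n. \<gamma> * (\<pi> i j * (ln (\<pi> i j) + C l i j / \<gamma>)) - \<gamma> * \<pi> i j)"
    unfolding frob_def entropy_def sum_distrib_left sum.distrib[symmetric]
    by (intro sum.cong refl) (use gamma_pos in \<open>simp add: algebra_simps\<close>)
  also have "\<dots> = \<gamma> * (\<Sum>i<n. \<Sum>j<n. \<pi> i j * (ln (\<pi> i j) + C l i j / \<gamma>)) - \<gamma> * (\<Sum>i<n. \<Sum>j<n. \<pi> i j)"
    by (simp only: sum_subtractf sum_distrib_left)
  also have "(\<Sum>i<n. \<Sum>j<n. \<pi> i j) = 1" by (simp add: assms p_sum)
  finally show ?thesis by (simp add: right_diff_distrib)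
qed

text \<open>Feasible plans share their second marginal \<open>r\<close>, so its pairing with
  \<open>v\<close> vanishes in the weighted mean and only the marginals of \<open>B\<close>
  remain.\<close>

lemma objective_diff_le:
  assumes feas: "feasible m n p \<pi>" and R: "\<And>l. l < m \<Longrightarrow> c l \<le> R"
  shows "objective m n C w \<gamma> (B (Suc k)) - objective m n C w \<gamma> \<pi> \<le> \<gamma> * R * gap (Suc k)"
proof -
  have row: "(\<Sum>j<n. \<pi> l i j) = p l i" if "l < m" "i < n" for l i
    using feas that by (simp add: feasible_def mat_vec_def ones_def)
  have nonneg: "0 \<le> \<pi> l i j" if "l < m" "i < n" "j < n" for l i j
    using feas that by (simp add: feasible_def)
  define r where "r j = (\<Sum>i<n. \<pi> 0 i j)" for j
  have col: "(\<Sum>i<n. \<pi> l i j) = r j" if "l < m" "j < n" for l j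
  proof -
    have "mat_vec n (mat_transpose (\<pi> l)) ones j = mat_vec n (mat_transpose (\<pi> 0)) ones j"
      using feas that m_pos unfolding feasible_def by blast
    then show ?thesis by (simp add: mat_vec_def ones_def mat_transpose_def r_def)
  qed
  let ?y = "v (Suc k)"
  have "objective m n C w \<gamma> (B (Suc k)) - objective m n C w \<gamma> \<pi>
      = (\<Sum>l<m. w l * (\<gamma> * ((\<Sum>i<n. \<Sum>j<n. B (Suc k) l i j * (ln (B (Suc k) l i j) + C l i j / \<gamma>))
          - (\<Sum>i<n. \<Sum>j<n. \<pi> l i j * (ln (\<pi> l i j) + C l i j / \<gamma>)))))"
    by (simp add: objective_def objective_summand_eq row B_row_sum right_diff_distrib sum_subtractf)
  also have "\<dots> \<le> (\<Sum>l<m. w l * (\<gamma> * ((\<Sum>j<n. q (Suc k) l j * ?y l j) - (\<Sum>j<n. r j * ?y l j))))"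
  proof (intro sum_mono mult_left_mono)
    fix l assume "l \<in> {..<m}"
    then have l: "l < m" by simp
    show "(\<Sum>i<n. \<Sum>j<n. B (Suc k) l i j * (ln (B (Suc k) l i j) + C l i j / \<gamma>))
          - (\<Sum>i<n. \<Sum>j<n. \<pi> l i j * (ln (\<pi> l i j) + C l i j / \<gamma>))
        \<le> (\<Sum>j<n. q (Suc k) l j * ?y l j) - (\<Sum>j<n. r j * ?y l j)"
      using gibbs_plan[OF l, of "\<pi> l" k] gibbs_plan_eq[OF l, of k]
      by (simp add: nonneg row l col)
  qed (use gamma_pos in \<open>auto intro: w_nonneg\<close>)
  also have "\<dots> = \<gamma> * ((\<Sum>l<m. w l * (\<Sum>j<n. q (Suc k) l j * ?y l j)) - (\<Sum>l<m. w l * (\<Sum>j<n. r j * ?y l j)))"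
    by (simp add: sum_distrib_left sum_subtractf right_diff_distrib mult_ac)
  also have "(\<Sum>l<m. w l * (\<Sum>j<n. r j * ?y l j)) = (\<Sum>j<n. r j * (\<Sum>l<m. w l * ?y l j))"
    unfolding sum_distrib_left by (subst sum.swap) (simp add: mult_ac)
  also have "\<dots> = 0" by (simp add: v_weighted_sum)
  also have "(\<Sum>l<m. w l * (\<Sum>j<n. q (Suc k) l j * ?y l j)) \<le> R * gap (Suc k)"
  proof (rule weighted_inner_le_gap)
    \<comment> \<open>With \<open>R\<close> bounding all \<open>c l\<close>, and hence their mean,
      \<open>v\<close> oscillates by at most \<open>2 * R\<close>.\<close>
    have avg: "(\<Sum>l<m. w l * c l) \<le> R"
    proof -
      have "(\<Sum>l<m. w l * c l) \<le> (\<Sum>l<m. w l * R)"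
        by (intro sum_mono mult_left_mono) (auto intro: w_nonneg R)
      then show ?thesis by (simp add: w_sum flip: sum_distrib_right)
    qed
    show "?y l i - ?y l j \<le> 2 * R" if "l < m" "i < n" "j < n" for l i j
      using v_osc[OF that, of k] R[OF that(1)] avg by linarith
  qed (simp add: v_weighted_sum)
  finally show ?thesis using gamma_pos by (simp add: mult_left_mono)
qed

section \<open>The number of rounds\<close>

lemma max_c: "l < m \<Longrightarrow> c l \<le> (MAX l\<in>{..<m}. max_entry n (C l)) / \<gamma>"
  unfolding c_def using gamma_pos by (intro divide_right_mono Max_ge) auto

lemma R_v_bounds:
  "0 \<le> R_v m n C w \<gamma>" "R_v m n C w \<gamma> \<le> 2 * ((MAX l\<in>{..<m}. max_entry n (C l)) / \<gamma>)"
proof -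
  have R_v: "R_v m n C w \<gamma> = (MAX l\<in>{..<m}. c l) + (\<Sum>l<m. w l * c l)"
    by (simp add: R_v_def c_def)
  have "c 0 \<le> (MAX l\<in>{..<m}. c l)" using m_pos by simp
  moreover have "0 \<le> (\<Sum>l<m. w l * c l)"
    by (intro sum_nonneg mult_nonneg_nonneg) (auto intro: c_nonneg w_nonneg)
  ultimately show "0 \<le> R_v m n C w \<gamma>" using c_nonneg[OF m_pos] R_v by linarith
  let ?R = "(MAX l\<in>{..<m}. max_entry n (C l)) / \<gamma>"
  have "(MAX l\<in>{..<m}. c l) \<le> ?R"
    using m_pos max_c by (intro Max.boundedI) auto
  moreover have "(\<Sum>l<m. w l * c l) \<le> (\<Sum>l<m. w l * ?R)"
    by (intro sum_mono mult_left_mono max_c) (auto intro: w_nonneg)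
  moreover have "(\<Sum>l<m. w l * ?R) = ?R" by (simp add: w_sum flip: sum_distrib_right sum_divide_distrib)
  ultimately show "R_v m n C w \<gamma> \<le> 2 * ?R" unfolding R_v by linarith
qed

lemma stopping_time_exists:
  assumes "0 < \<epsilon>"
  obtains k where "gap (Suc k) \<le> \<epsilon>" "\<And>k'. k' < k \<Longrightarrow> \<epsilon> < gap (Suc k')"
    "real (2 * Suc k) \<le> 4 + 44 * R_v m n C w \<gamma> / \<epsilon>"
proof -
  have R_v: "R_v m n C w \<gamma> = (MAX l\<in>{..<m}. c l) + (\<Sum>l<m. w l * c l)"
    by (simp add: R_v_def c_def)
  have cR: "c l + (\<Sum>l'<m. w l' * c l') \<le> R_v m n C w \<gamma>" if "l < m" for l
    unfolding R_v using that by simp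
  have bound: "real M \<le> 1 + 22 * R_v m n C w \<gamma> / \<epsilon>"
    if "0 < M" "\<And>k. k < M \<Longrightarrow> \<epsilon> < gap (Suc k)" for M
  proof (rule descent_length_bound[where F = "\<lambda>k. dual_value (Suc k)" and g = "\<lambda>k. gap (Suc k)"])
    \<comment> \<open>Enlarging 9 to 11 is allowed because the descent is nonnegative; 11 per phase
      yields 22 for rounds and 44 for half-steps.\<close>
    show "(gap (Suc k))\<^sup>2 \<le> 11 * (dual_value (Suc k) - dual_value (Suc (Suc k)))" for k
      using gap_sq_le_descent[of k] by (smt (verit) zero_le_power2)
  qed (use that assms dual_value_diff_le[OF cR] in auto)
  have "\<exists>k. gap (Suc k) \<le> \<epsilon>"
  proof (rule ccontr)
    assume "\<not> ?thesis"
    then have all: "real M \<le> 1 + 22 * R_v m n C w \<gamma> / \<epsilon>" if "0 < M" for M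
      using bound that by (simp add: not_le)
    obtain M where "1 + 22 * R_v m n C w \<gamma> / \<epsilon> < real M" using reals_Archimedean2 by blast
    with all[of "Suc M"] show False by simp
  qed
  define k where "k = (LEAST k. gap (Suc k) \<le> \<epsilon>)"
  have least: "\<epsilon> < gap (Suc k')" if "k' < k" for k'
    using not_less_Least[of k' "\<lambda>k. gap (Suc k) \<le> \<epsilon>"] that by (simp add: k_def not_le)
  \<comment> \<open>Exactly \<open>k\<close> rounds precede the stopping round. Counting that round
    and doubling turns \<open>1 + 22 * R / \<epsilon>\<close> into
    \<open>4 + 44 * R / \<epsilon>\<close>.\<close>
  have "real k \<le> 1 + 22 * R_v m n C w \<gamma> / \<epsilon>"
    using bound[of k] least assms R_v_bounds(1) by (cases "k = 0") auto
  moreover have "gap (Suc k) \<le> \<epsilon>"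
    unfolding k_def by (rule LeastI_ex) fact
  ultimately show ?thesis using that[of k] least by simp
qed

lemma dibp_exit_iff: "dibp_exit m n p C w \<gamma> \<epsilon> t \<longleftrightarrow> (\<exists>k. t = 2 * Suc k \<and> gap (Suc k) \<le> \<epsilon>)"
proof
  assume "dibp_exit m n p C w \<gamma> \<epsilon> t"
  then have t: "0 < t" "even t" "marginal_gap m n w (dibp_plan m n p C w \<gamma> t) \<le> \<epsilon>"
    by (auto simp: dibp_exit_def)
  then obtain k where "t = 2 * Suc k" by (metis evenE gr0_conv_Suc mult_0_right not_gr0)
  with t(3) show "\<exists>k. t = 2 * Suc k \<and> gap (Suc k) \<le> \<epsilon>" by (metis marginal_gap_eq)
next
  assume "\<exists>k. t = 2 * Suc k \<and> gap (Suc k) \<le> \<epsilon>"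
  then show "dibp_exit m n p C w \<gamma> \<epsilon> t"
    by (auto simp: dibp_exit_def marginal_gap_eq simp del: mult_Suc_right)
qed

end

section \<open>The uniform asymptotic bound\<close>

lemma iteration_bound_bigo:
  "(\<lambda>(m, n, p, C, w, \<gamma>, \<epsilon>). 4 + 44 * R_v m n C w \<gamma> / \<epsilon>)
     \<in> O[large_cost_ratio](\<lambda>(m, n, p, C, w, \<gamma>, \<epsilon>). cost_ratio m n C \<gamma> \<epsilon>)"
\<comment> \<open>\<open>92 = 4 + 44 * 2\<close>: once the cost ratio is at least one, 4 is at most
  four times it, and \<open>R_v / \<epsilon>\<close> is at most twice it.\<close>
proof (rule bigoI[where c = 92])
  have "norm (4 + 44 * R_v m n C w \<gamma> / \<epsilon>) \<le> 92 * norm (cost_ratio m n C \<gamma> \<epsilon>)"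
    if data: "barycenter_data m n p C w \<gamma>" and eps: "0 < \<epsilon>" and large: "1 \<le> cost_ratio m n C \<gamma> \<epsilon>"
    for m n p C w \<gamma> \<epsilon>
  proof -
    interpret barycenter_problem m n p C w \<gamma> by unfold_locales (rule data)
    have "R_v m n C w \<gamma> / \<epsilon> \<le> 2 * cost_ratio m n C \<gamma> \<epsilon>"
      using divide_right_mono[OF R_v_bounds(2), of \<epsilon>] eps by (simp add: cost_ratio_def)
    moreover have "0 \<le> R_v m n C w \<gamma> / \<epsilon>" using R_v_bounds(1) eps by simp
    ultimately show ?thesis using large by simp
  qed
  then show "\<forall>\<^sub>F x in large_cost_ratio.
      norm (case x of (m, n, p, C, w, \<gamma>, \<epsilon>) \<Rightarrow> 4 + 44 * R_v m n C w \<gamma> / \<epsilon>)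
        \<le> 92 * norm (case x of (m, n, p, C, w, \<gamma>, \<epsilon>) \<Rightarrow> cost_ratio m n C \<gamma> \<epsilon>)"
    unfolding large_cost_ratio_def eventually_inf_principal eventually_filtercomap
    by (intro exI[of _ "\<lambda>x. 1 \<le> x"] conjI eventually_ge_at_top) auto
qed

theorem theorem1:
  fixes m n :: nat
    and p :: "nat \<Rightarrow> nat \<Rightarrow> real"
    and C :: "nat \<Rightarrow> nat \<Rightarrow> nat \<Rightarrow> real"
    and w :: "nat \<Rightarrow> real"
    and \<gamma> \<epsilon> :: real
  assumes "barycenter_data m n p C w \<gamma>"
    and "0 < \<epsilon>"
  shows "(\<exists>N. dibp_stops_after m n p C w \<gamma> \<epsilon> N \<and>
            real N \<le> 4 + 44 * R_v m n C w \<gamma> / \<epsilon> \<and>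
            (let B = dibp_plan m n p C w \<gamma> N;
                 q = mean_marginal m n w B
             in (\<Sum>l<m. w l * l1_norm n (\<lambda>j. mat_vec n (mat_transpose (B l)) ones j - q j)) \<le> \<epsilon> \<and>
                (\<forall>\<pi>. barycenter_solution m n p C w \<gamma> \<pi> \<longrightarrow>
                   objective m n C w \<gamma> B - objective m n C w \<gamma> \<pi>
                     \<le> (MAX l\<in>{..<m}. max_entry n (C l)) * \<epsilon>)))
       \<and> (\<lambda>(m, n, p, C, w, \<gamma>, \<epsilon>). 4 + 44 * R_v m n C w \<gamma> / \<epsilon>)
           \<in> O[large_cost_ratio](\<lambda>(m, n, p, C, w, \<gamma>, \<epsilon>). cost_ratio m n C \<gamma> \<epsilon>)"
proof (intro conjI iteration_bound_bigo)
  interpret barycenter_problem m n p C w \<gamma> by unfold_locales (rule assms(1))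
  obtain k where k: "gap (Suc k) \<le> \<epsilon>" "\<And>k'. k' < k \<Longrightarrow> \<epsilon> < gap (Suc k')"
    and N: "real (2 * Suc k) \<le> 4 + 44 * R_v m n C w \<gamma> / \<epsilon>"
    using stopping_time_exists[OF assms(2)] by blast
  define N where "N = 2 * Suc k"
  let ?B = "dibp_plan m n p C w \<gamma> N" and ?R = "MAX l\<in>{..<m}. max_entry n (C l)"
  have stops: "dibp_stops_after m n p C w \<gamma> \<epsilon> N"
    unfolding dibp_stops_after_def dibp_exit_iff N_def using k by force
  have gap: "marginal_gap m n w ?B \<le> \<epsilon>"
    using k(1) by (metis N_def marginal_gap_eq)
  have obj: "objective m n C w \<gamma> ?B - objective m n C w \<gamma> \<pi> \<le> ?R * \<epsilon>"
    if "barycenter_solution m n p C w \<gamma> \<pi>" for \<pi>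
  proof -
    have "feasible m n p \<pi>"
      using that by (simp add: barycenter_solution_def is_arg_min_def)
    \<comment> \<open>Taking \<open>R\<close> as the maximal cost divided by \<open>\<gamma>\<close>
      cancels the factor \<open>\<gamma>\<close>.\<close>
    from objective_diff_le[OF this max_c, of k]
    have "objective m n C w \<gamma> ?B - objective m n C w \<gamma> \<pi> \<le> ?R * gap (Suc k)"
      using gamma_pos unfolding N_def objective_dibp_plan by simp
    also have "\<dots> \<le> ?R * \<epsilon>"
      using k(1) order_trans[OF c_nonneg max_c, OF m_pos m_pos] gamma_pos
      by (intro mult_left_mono) (auto simp: zero_le_divide_iff)
    finally show ?thesis .
  qed
  show "\<exists>N. dibp_stops_after m n p C w \<gamma> \<epsilon> N \<and>
            real N \<le> 4 + 44 * R_v m n C w \<gamma> / \<epsilon> \<and>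
            (let B = dibp_plan m n p C w \<gamma> N;
                 q = mean_marginal m n w B
             in (\<Sum>l<m. w l * l1_norm n (\<lambda>j. mat_vec n (mat_transpose (B l)) ones j - q j)) \<le> \<epsilon> \<and>
                (\<forall>\<pi>. barycenter_solution m n p C w \<gamma> \<pi> \<longrightarrow>
                   objective m n C w \<gamma> B - objective m n C w \<gamma> \<pi>
                     \<le> (MAX l\<in>{..<m}. max_entry n (C l)) * \<epsilon>))"
    using stops N gap obj unfolding Let_def marginal_gap_def N_def by blast
qed

end
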